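(* Let $\mathbf A\in L(\mathbb R^n)$ be an invertible operator with $\sup_{k\in\mathbb Z}\|\mathbf A^k\|<\infty$, and let $X^*(t)$, $t\ge 0$, be the solution of the set differential equation $D_HX(t)=\mathbf AX(t)$ with initial value $X^*(0)=X_0^*\in\operatorname{conv}\mathbb R^n$, where $\operatorname{int}X_0^*\neq\emptyset$. Then $X^*(t)$ is Lyapunov stable: for every $\varepsilon>0$ there exists $\delta=\delta(\varepsilon,X_0^* )>0$ such that for every $X_0\in\mathfrak C$ with $\rho[\operatorname{Or}_{\mathfrak G}(X_0),\operatorname{Or}_{\mathfrak G}(X_0^* )]<\delta$, the solution $X(t)$ of $D_HX(t)=\mathbf AX(t)$, $X(0)=X_0$, satisfies $\rho[\operatorname{Or}_{\mathfrak G}(X(t)),\operatorname{Or}_{\mathfrak G}(X^*(t))]<\varepsilon$ for all $t\ge 0$.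
   Context: $\operatorname{conv}\mathbb R^n$ is the space of nonempty convex compact subsets of $\mathbb R^n$ with the Hausdorff metric $d_H$. $\mathfrak C=\{X\in\operatorname{conv}\mathbb R^n : \operatorname{int}X\neq\emptyset\}$. $\mathbf AX=\{\mathbf Ax: x\in X\}$; sums of sets are Minkowski sums. $V[X]$ is the volume. Hukuhara derivative: for $X,Y\in\operatorname{conv}\mathbb R^n$, the Hukuhara difference $X\ominus Y$ is the set $Z\in\operatorname{conv}\mathbb R^n$ with $X=Y+Z$, if it exists. $D_HX(t)$ is the element of $\operatorname{conv}\mathbb R^n$ that is the common $d_H$-limit, as $h\to0^+$, of $h^{-1}(X(t+h)\ominus X(t))$ and $h^{-1}(X(t)\ominus X(t-h))$ (only the first at $t=0$). The Cauchy problem $D_HX=\mathbf AX$, $X(0)=X_0$, has a unique solution on $[0,\infty)$, equivalently $X(t)=X_0+\int_0^t\mathbf AX(s)\,ds$ (set-valued integral); if $X_0\in\mathfrak C$ then $X(t)\in\mathfrak C$ for all $t\ge0$. $\mathfrak G$ is the group of homotheties $x\mapsto\lambda x+b$, $\lambda>0$, $b\in\mathbb R^n$, of $\mathbb R^n$, and $\operatorname{Or}_{\mathfrak G}(X)=\{\mathfrak gX:\mathfrak g\in\mathfrak G\}$ is the orbit (shape) of $X$. For $X\in\mathfrak C$ put $\widetilde X=X/\sqrt[n]{V[X]}$. For $X,Y\in\mathfrak C$, $$\rho[\operatorname{Or}_{\mathfrak G}(X),\operatorname{Or}_{\mathfrak G}(Y)]=\inf\{d_H(\widetilde X,\widetilde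 Y+x): x\in\mathbb R^n\}.$$ *)

theory Defs
  imports "HOL-Analysis.Analysis"
begin

subsection \<open>Compact convex sets and the Hausdorff metric\<close>

definition conv_sets :: "'a::euclidean_space set set" where
  "conv_sets = {X. X \<noteq> {} \<and> convex X \<and> compact X}"

definition conv_bodies :: "'a::euclidean_space set set" where
  "conv_bodies = {X \<in> conv_sets. interior X \<noteq> {}}"

definition hausdorff_dist :: "'a::metric_space set \<Rightarrow> 'a set \<Rightarrow> real" where
  "hausdorff_dist X Y = max (SUP x\<in>X. infdist x Y) (SUP y\<in>Y. infdist y X)"

subsection \<open>Hukuhara difference and derivative\<close>

text \<open>Sums of sets are the Minkowski sums of \<^theory>\<open>HOL-Library.Set_Algebras\<close>.\<close>

definition hukuhara_diff_exists :: "'a::euclidean_space set \<Rightarrow> 'a set \<Rightarrow> bool" where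
  "hukuhara_diff_exists X Y \<longleftrightarrow> (\<exists>Z\<in>conv_sets. X = Y + Z)"

definition hukuhara_diff :: "'a::euclidean_space set \<Rightarrow> 'a set \<Rightarrow> 'a set" where
  "hukuhara_diff X Y = (THE Z. Z \<in> conv_sets \<and> X = Y + Z)"

text \<open>The derivative of a set-valued function on \<open>[0, \<infinity>)\<close>; at \<open>0\<close> it is one-sided.\<close>

definition has_hukuhara_derivative ::
    "(real \<Rightarrow> 'a::euclidean_space set) \<Rightarrow> 'a set \<Rightarrow> real \<Rightarrow> bool" where
  "has_hukuhara_derivative X D t \<longleftrightarrow>
     D \<in> conv_sets \<and>
     (\<forall>\<^sub>F h in at_right 0. hukuhara_diff_exists (X (t + h)) (X t)) \<and>
     ((\<lambda>h. hausdorff_dist ((*\<^sub>R) (inverse h) ` hukuhara_diff (X (t + h)) (X t)) D)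
        \<longlongrightarrow> 0) (at_right 0) \<and>
     (0 < t \<longrightarrow>
       (\<forall>\<^sub>F h in at_right 0. hukuhara_diff_exists (X t) (X (t - h))) \<and>
       ((\<lambda>h. hausdorff_dist ((*\<^sub>R) (inverse h) ` hukuhara_diff (X t) (X (t - h))) D)
          \<longlongrightarrow> 0) (at_right 0))"

definition solves_set_ode ::
    "('a::euclidean_space \<Rightarrow> 'a) \<Rightarrow> 'a set \<Rightarrow> (real \<Rightarrow> 'a set) \<Rightarrow> bool" where
  "solves_set_ode A X\<^sub>0 X \<longleftrightarrow>
     X 0 = X\<^sub>0 \<and>
     (\<forall>t\<ge>0. X t \<in> conv_sets \<and> has_hukuhara_derivative X (A ` X t) t)"

subsection \<open>Shapes\<close>

definition homotheties :: "('a::real_vector \<Rightarrow> 'a) set" where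
  "homotheties = {\<lambda>x. l *\<^sub>R x + b | l b. 0 < l}"

definition homothety_orbit :: "'a::real_vector set \<Rightarrow> 'a set set" where
  "homothety_orbit X = {g ` X | g. g \<in> homotheties}"

definition unit_volume :: "'a::euclidean_space set \<Rightarrow> 'a set" where
  "unit_volume X = (*\<^sub>R) (inverse (root DIM('a) (measure lebesgue X))) ` X"

definition body_shape_dist :: "'a::euclidean_space set \<Rightarrow> 'a set \<Rightarrow> real" where
  "body_shape_dist X Y =
     (INF x. hausdorff_dist (unit_volume X) ((\<lambda>y. y + x) ` unit_volume Y))"

text \<open>The distance of two orbits, computed from arbitrary representatives;
  \<open>shape_dist_orbit\<close> below shows that the choice is irrelevant.\<close>

definition shape_dist :: "'a::euclidean_space set set \<Rightarrow> 'a set set \<Rightarrow> real" where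
  "shape_dist P Q =
     (THE r. \<exists>X\<in>conv_bodies. \<exists>Y\<in>conv_bodies.
        P = homothety_orbit X \<and> Q = homothety_orbit Y \<and> r = body_shape_dist X Y)"

subsection \<open>Powers of an operator\<close>

definition int_power :: "('a \<Rightarrow> 'a) \<Rightarrow> int \<Rightarrow> 'a \<Rightarrow> 'a" where
  "int_power A k = (if 0 \<le> k then A ^^ nat k else inv A ^^ nat (- k))"

subsection \<open>The definitions by description are well defined\<close>

lemma minkowski_cancel_subset:
  fixes X Z W :: "'a::euclidean_space set"
  assumes X: "X \<in> conv_sets" and Z: "Z \<in> conv_sets" and W: "W \<in> conv_sets"
    and eq: "X + Z = X + W"
  shows "Z \<subseteq> W"
proof
  fix z assume z: "z \<in> Z"
  show "z \<in> W"
  proof (rule ccontr)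
    assume "z \<notin> W"
    have "convex W" "closed W"
      using W by (auto simp: conv_sets_def compact_imp_closed)
    from separating_hyperplane_closed_point[OF this \<open>z \<notin> W\<close>]
    obtain a b where ab: "inner a z < b" "\<forall>w\<in>W. inner a w > b"
      by blast
    have "compact X" "X \<noteq> {}" using X by (auto simp: conv_sets_def)
    moreover have "continuous_on X (\<lambda>x. inner a x)" by (intro continuous_intros)
    ultimately obtain x where x: "x \<in> X" "\<And>y. y \<in> X \<Longrightarrow> inner a x \<le> inner a y"
      using continuous_attains_inf[of X "\<lambda>x. inner a x"] by blast
    have "x + z \<in> X + W" using x(1) z eq by (metis set_plus_intro)
    then obtain y w where yw: "y \<in> X" "w \<in> W" "x + z = y + w" by (auto simp: set_plus_def)
    then have "inner a x + inner a z = inner a y + inner a w"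
      by (metis inner_add_right)
    then show False using x(2)[OF yw(1)] ab(1) bspec[OF ab(2) yw(2)] by linarith
  qed
qed

lemma hukuhara_diff_eq:
  fixes X Y Z :: "'a::euclidean_space set"
  assumes "Y \<in> conv_sets" "Z \<in> conv_sets" "X = Y + Z"
  shows "hukuhara_diff X Y = Z"
  unfolding hukuhara_diff_def
proof (rule the_equality)
  fix W assume W: "W \<in> conv_sets \<and> X = Y + W"
  show "W = Z"
  proof (rule antisym)
    show "W \<subseteq> Z"
      by (rule minkowski_cancel_subset[of Y]) (use assms W in simp_all)
    show "Z \<subseteq> W"
      by (rule minkowski_cancel_subset[of Y]) (use assms W in simp_all)
  qed
qed (use assms in simp)

lemma hausdorff_dist_translate:
  fixes X Y :: "'a::real_normed_vector set"
  shows "hausdorff_dist ((\<lambda>y. y + c) ` X) ((\<lambda>y. y + c) ` Y) = hausdorff_dist X Y"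
proof -
  have "infdist (x + c) ((\<lambda>y. y + c) ` Z) = infdist x Z" for x and Z :: "'a set"
    by (simp add: infdist_def image_image)
  then show ?thesis by (simp add: hausdorff_dist_def image_image)
qed

lemma conv_bodies_measure_pos:
  fixes X :: "'a::euclidean_space set"
  assumes "X \<in> conv_bodies"
  shows "0 < measure lebesgue X"
proof -
  have "compact X" "interior X \<noteq> {}" "convex X"
    using assms by (auto simp: conv_bodies_def conv_sets_def)
  then have "X \<in> lmeasurable" "\<not> negligible X"
    by (auto simp: lmeasurable_compact negligible_convex_interior)
  then show ?thesis
    by (simp add: negligible_iff_measure zero_less_measure_iff)
qed

lemma unit_volume_homothety:
  fixes X :: "'a::euclidean_space set"
  assumes X: "X \<in> conv_bodies" and l: "0 < l"
  shows "\<exists>c. unit_volume ((\<lambda>x. l *\<^sub>R x + b) ` X) = (\<lambda>y. y + c) ` unit_volume X"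
proof -
  define m where "m = root DIM('a) (measure lebesgue X)"
  have m: "m > 0" using conv_bodies_measure_pos[OF X] by (simp add: m_def)
  have "measure lebesgue ((\<lambda>x. l *\<^sub>R x + b) ` X) = l ^ DIM('a) * measure lebesgue X"
    using measure_lebesgue_affine[of l b X] l by (simp add: add.commute)
  then have r: "root DIM('a) (measure lebesgue ((\<lambda>x. l *\<^sub>R x + b) ` X)) = l * m"
    using l by (simp add: real_root_mult real_root_power_cancel m_def)
  have "unit_volume ((\<lambda>x. l *\<^sub>R x + b) ` X) =
        (\<lambda>y. y + inverse (l * m) *\<^sub>R b) ` unit_volume X"
    unfolding unit_volume_def r m_def[symmetric] image_image
    using l m by (intro image_cong) (auto simp: scaleR_add_right)
  then show ?thesis by blast
qed

lemma homothety_orbit_refl: "X \<in> homothety_orbit X"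
proof -
  have "(\<lambda>x::'a. x) \<in> homotheties"
    unfolding homotheties_def mem_Collect_eq by (intro exI[of _ 1] exI[of _ 0]) simp
  moreover have "X = (\<lambda>x. x) ` X" by simp
  ultimately show ?thesis unfolding homothety_orbit_def by blast
qed

lemma body_shape_dist_orbit_cong:
  fixes X Y :: "'a::euclidean_space set"
  assumes X: "X \<in> conv_bodies" and Y: "Y \<in> conv_bodies"
    and eq: "homothety_orbit X' = homothety_orbit X" "homothety_orbit Y' = homothety_orbit Y"
  shows "body_shape_dist X' Y' = body_shape_dist X Y"
proof -
  have *: "\<exists>c. unit_volume Z' = (\<lambda>y. y + c) ` unit_volume Z"
    if "Z \<in> conv_bodies" "homothety_orbit Z' = homothety_orbit Z" for Z Z' :: "'a set"
  proof -
    have "Z' \<in> homothety_orbit Z" using that(2) homothety_orbit_refl by blast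
    then obtain l b where "l > 0" "Z' = (\<lambda>x. l *\<^sub>R x + b) ` Z"
      by (auto simp: homothety_orbit_def homotheties_def)
    then show ?thesis using unit_volume_homothety[OF that(1)] by simp
  qed
  obtain c d where c: "unit_volume X' = (\<lambda>y. y + c) ` unit_volume X"
    and d: "unit_volume Y' = (\<lambda>y. y + d) ` unit_volume Y"
    using *[OF X eq(1)] *[OF Y eq(2)] by blast
  define f where "f x = hausdorff_dist (unit_volume X) ((\<lambda>y. y + x) ` unit_volume Y)" for x
  have "hausdorff_dist (unit_volume X') ((\<lambda>y. y + x) ` unit_volume Y') = f (x + (d - c))" for x
  proof -
    have "(\<lambda>y. y + x) ` unit_volume Y' = (\<lambda>y. y + c) ` (\<lambda>y. y + (x + (d - c))) ` unit_volume Y"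
      unfolding d image_image by (intro image_cong) (auto simp: algebra_simps)
    then show ?thesis by (simp only: c hausdorff_dist_translate f_def)
  qed
  then have "body_shape_dist X' Y' = (INF x. f (x + (d - c)))"
    by (simp add: body_shape_dist_def)
  also have "range (\<lambda>x. f (x + (d - c))) = range f"
  proof (intro antisym subsetI)
    fix y assume "y \<in> range f"
    then obtain x where "y = f x" by blast
    then have "y = f ((x - (d - c)) + (d - c))" by simp
    then show "y \<in> range (\<lambda>x. f (x + (d - c)))" by blast
  qed auto
  finally show ?thesis by (simp add: body_shape_dist_def f_def)
qed

lemma shape_dist_orbit:
  fixes X Y :: "'a::euclidean_space set"
  assumes "X \<in> conv_bodies" "Y \<in> conv_bodies"
  shows "shape_dist (homothety_orbit X) (homothety_orbit Y) = body_shape_dist X Y"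
  unfolding shape_dist_def
proof (rule the_equality)
  fix r
  assume "\<exists>X'\<in>conv_bodies. \<exists>Y'\<in>conv_bodies. homothety_orbit X = homothety_orbit X' \<and>
      homothety_orbit Y = homothety_orbit Y' \<and> r = body_shape_dist X' Y'"
  then obtain X' Y' where eq: "homothety_orbit X = homothety_orbit X'"
      "homothety_orbit Y = homothety_orbit Y'" and r: "r = body_shape_dist X' Y'"
    by blast
  show "r = body_shape_dist X Y"
    unfolding r by (rule body_shape_dist_orbit_cong[OF assms eq[symmetric]])
qed (use assms in blast)

end

theory Submission
  imports Defs
begin

text \<open>
  Let \<open>h(t, p)\<close> be the support function of \<open>X(t)\<close> and \<open>B\<close> the adjoint of \<open>A\<close>. The Hukuhara equation gives
  \<open>\<partial>h/\<partial>t (t, p) = h(t, B p)\<close>, whence \<open>h(t, p) = (\<Sum>k. t^k / k! * h(0, B^k p))\<close>. Since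
  \<open>|p| / M \<le> |B^k p| \<le> M |p|\<close>, up to the factor \<open>exp t\<close> the inradius and circumradius of \<open>X\<^sup>*(t)\<close> stay
  comparable to those of \<open>X\<^sup>*(0)\<close>, and an initial distance \<open>d\<close> between \<open>X(0)\<close> and a homothetic copy of
  \<open>X\<^sup>*(0)\<close> becomes a distance of at most \<open>M d exp t\<close> between \<open>X(t)\<close> and a homothetic copy of \<open>X\<^sup>*(t)\<close>.
  The factor \<open>exp t\<close> cancels on passing to shapes, because the shape distance is controlled by the
  ratios of distance and circumradius to the inradius.
\<close>

section \<open>Support functions\<close>

definition support_fun :: "'a::euclidean_space set \<Rightarrow> 'a \<Rightarrow> real" where
  "support_fun X p = (SUP x\<in>X. x \<bullet> p)"

lemma support_fun_eqI:
  assumes "x \<in> X" "\<And>y. y \<in> X \<Longrightarrow> y \<bullet> p \<le> x \<bullet> p"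
  shows "support_fun X p = x \<bullet> p"
  unfolding support_fun_def using assms by (intro cSup_eq_maximum) auto

lemma support_fun_attained:
  assumes "X \<in> conv_sets"
  obtains x where "x \<in> X" "support_fun X p = x \<bullet> p" "\<And>y. y \<in> X \<Longrightarrow> y \<bullet> p \<le> x \<bullet> p"
proof -
  have "compact X" "X \<noteq> {}" using assms by (auto simp: conv_sets_def)
  moreover have "continuous_on X (\<lambda>x. x \<bullet> p)" by (intro continuous_intros)
  ultimately obtain x where "x \<in> X" "\<And>y. y \<in> X \<Longrightarrow> y \<bullet> p \<le> x \<bullet> p"
    using continuous_attains_sup[of X "\<lambda>x. x \<bullet> p"] by blast
  then show thesis using that support_fun_eqI by blast
qed

lemma inner_le_support_fun:
  assumes "X \<in> conv_sets" "x \<in> X"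
  shows "x \<bullet> p \<le> support_fun X p"
  using support_fun_attained[OF assms(1), of p] assms(2) by metis

text \<open>A sum of maximisers is a maximiser. This additivity is what makes Hukuhara differences
  tractable: they become differences of support functions.\<close>

lemma support_fun_plus:
  assumes "X \<in> conv_sets" "Y \<in> conv_sets"
  shows "support_fun (X + Y) p = support_fun X p + support_fun Y p"
proof -
  obtain x where x: "x \<in> X" "support_fun X p = x \<bullet> p" "\<And>z. z \<in> X \<Longrightarrow> z \<bullet> p \<le> x \<bullet> p"
    using support_fun_attained[OF assms(1)] by metis
  obtain y where y: "y \<in> Y" "support_fun Y p = y \<bullet> p" "\<And>z. z \<in> Y \<Longrightarrow> z \<bullet> p \<le> y \<bullet> p"
    using support_fun_attained[OF assms(2)] by metis
  have "support_fun (X + Y) p = (x + y) \<bullet> p"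
    using x y by (intro support_fun_eqI) (auto simp: set_plus_def inner_add_left intro!: add_mono)
  then show ?thesis using x y by (simp add: inner_add_left)
qed

lemma support_fun_homothety:
  assumes "X \<in> conv_sets" "0 \<le> l"
  shows "support_fun ((\<lambda>x. l *\<^sub>R x + b) ` X) p = l * support_fun X p + b \<bullet> p"
proof -
  obtain x where x: "x \<in> X" "support_fun X p = x \<bullet> p" "\<And>z. z \<in> X \<Longrightarrow> z \<bullet> p \<le> x \<bullet> p"
    using support_fun_attained[OF assms(1)] by metis
  have "support_fun ((\<lambda>x. l *\<^sub>R x + b) ` X) p = (l *\<^sub>R x + b) \<bullet> p"
    using x assms(2) by (intro support_fun_eqI) (auto simp: inner_add_left intro!: mult_left_mono)
  then show ?thesis using x by (simp add: inner_add_left)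
qed

lemma support_fun_scaleR:
  assumes "X \<in> conv_sets" "0 \<le> l"
  shows "support_fun ((*\<^sub>R) l ` X) p = l * support_fun X p"
  using support_fun_homothety[OF assms, of 0] by simp

lemma support_fun_linear_image:
  assumes "X \<in> conv_sets" "linear A"
  shows "support_fun (A ` X) p = support_fun X (adjoint A p)"
proof -
  obtain x where x: "x \<in> X" "support_fun X (adjoint A p) = x \<bullet> adjoint A p"
      "\<And>z. z \<in> X \<Longrightarrow> z \<bullet> adjoint A p \<le> x \<bullet> adjoint A p"
    using support_fun_attained[OF assms(1)] by metis
  have "support_fun (A ` X) p = A x \<bullet> p"
    using x by (intro support_fun_eqI) (auto simp: adjoint_works[OF assms(2)])
  then show ?thesis using x by (simp add: adjoint_works[OF assms(2)])
qed

lemma conv_sets_homothety: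
  assumes "X \<in> conv_sets"
  shows "(\<lambda>x. l *\<^sub>R x + b) ` X \<in> conv_sets"
  using assms convex_affinity[of X b l] compact_affinity[of X b l]
  by (simp add: conv_sets_def add.commute)

lemma conv_sets_scaleR:
  assumes "X \<in> conv_sets"
  shows "(*\<^sub>R) l ` X \<in> conv_sets"
  using conv_sets_homothety[OF assms, of l 0] by simp

lemma subset_if_support_fun_le:
  assumes "X \<in> conv_sets" "Y \<in> conv_sets" "\<And>p. support_fun X p \<le> support_fun Y p"
  shows "X \<subseteq> Y"
proof
  fix x assume x: "x \<in> X"
  show "x \<in> Y"
  proof (rule ccontr)
    assume "x \<notin> Y"
    have "convex Y" "closed Y"
      using assms(2) by (auto simp: conv_sets_def compact_imp_closed)
    from separating_hyperplane_closed_point[OF this \<open>x \<notin> Y\<close>]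
    obtain a b where ab: "inner a x < b" "\<forall>w\<in>Y. inner a w > b"
      by blast
    \<comment> \<open>The separating hyperplane puts \<open>Y\<close> on the side where
      \<open>inner a\<close> is large, so \<open>- a\<close> is the direction in which
      \<open>x\<close> sticks out of \<open>Y\<close>.\<close>
    obtain y where y: "y \<in> Y" "support_fun Y (- a) = y \<bullet> (- a)"
      using support_fun_attained[OF assms(2)] by metis
    have "x \<bullet> (- a) \<le> y \<bullet> (- a)"
      using inner_le_support_fun[OF assms(1) x, of "- a"] assms(3)[of "- a"] y(2) by linarith
    then show False using ab y(1) by (auto simp: inner_commute)
  qed
qed

section \<open>Inscribed balls and nonempty interior\<close>

lemma support_fun_cball:
  assumes "0 \<le> r"
  shows "support_fun (cball c r) p = c \<bullet> p + r * norm p"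
proof -
  \<comment> \<open>For \<open>p = 0\<close> the quotient \<open>r / norm p\<close> is 0, so
    \<open>x\<close> is the centre \<open>c\<close>, which is then a maximiser as well.\<close>
  define x where "x = c + (r / norm p) *\<^sub>R p"
  have "x \<in> cball c r" using assms by (auto simp: x_def dist_norm)
  moreover have "x \<bullet> p = c \<bullet> p + r * norm p"
    by (auto simp: x_def inner_add_left dot_square_norm power2_eq_square)
  moreover have "y \<bullet> p \<le> c \<bullet> p + r * norm p" if "y \<in> cball c r" for y
  proof -
    have "(y - c) \<bullet> p \<le> norm (y - c) * norm p" by (rule norm_cauchy_schwarz)
    also have "\<dots> \<le> r * norm p"
      using that by (intro mult_right_mono) (auto simp: dist_norm norm_minus_commute)
    finally show ?thesis by (simp add: inner_diff_left)
  qed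
  ultimately show ?thesis by (metis support_fun_eqI)
qed

lemma cball_in_conv_sets: "0 \<le> r \<Longrightarrow> cball c r \<in> conv_sets"
  by (simp add: conv_sets_def)

lemma cball_subset_if_support_fun_ge:
  assumes "X \<in> conv_sets" "0 \<le> r" "\<And>p. c \<bullet> p + r * norm p \<le> support_fun X p"
  shows "cball c r \<subseteq> X"
  using assms by (intro subset_if_support_fun_le) (auto simp: support_fun_cball cball_in_conv_sets)

lemma support_fun_ge_if_cball_subset:
  assumes "X \<in> conv_sets" "0 \<le> r" "cball c r \<subseteq> X"
  shows "c \<bullet> p + r * norm p \<le> support_fun X p"
proof -
  obtain x where "x \<in> cball c r" "support_fun (cball c r) p = x \<bullet> p"
    using support_fun_attained[OF cball_in_conv_sets[OF assms(2)]] by metis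
  then show ?thesis
    using inner_le_support_fun[OF assms(1), of x p] assms by (auto simp: support_fun_cball)
qed

text \<open>Together with the converse below, this turns nonempty interior into an inequality
  between support functions, a form that can be summed term by term along a series.\<close>

lemma conv_bodies_if_support_fun_ge:
  assumes "X \<in> conv_sets" "0 < r" "\<And>p. c \<bullet> p + r * norm p \<le> support_fun X p"
  shows "X \<in> conv_bodies"
proof -
  have "cball c r \<subseteq> X" using assms by (intro cball_subset_if_support_fun_ge) auto
  then have "ball c r \<subseteq> interior X" using interior_mono[of "cball c r" X] by simp
  then have "interior X \<noteq> {}" using assms(2) by (metis centre_in_ball empty_iff subset_iff)
  then show ?thesis using assms(1) by (simp add: conv_bodies_def)
qed

lemma conv_bodies_obtain_cball:
  assumes "X \<in> conv_bodies"
  obtains c r where "0 < r" "\<And>p. c \<bullet> p + r * norm p \<le> support_fun X p"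
proof -
  have X: "X \<in> conv_sets" "interior X \<noteq> {}" using assms by (auto simp: conv_bodies_def)
  then obtain c r where r: "0 < r" "cball c r \<subseteq> X" by (metis ex_in_conv mem_interior_cball)
  then have "c \<bullet> p + r * norm p \<le> support_fun X p" for p
    using X by (intro support_fun_ge_if_cball_subset) auto
  then show thesis using that r by blast
qed

lemma conv_bodies_homothety:
  assumes "X \<in> conv_bodies" "0 < l"
  shows "(\<lambda>x. l *\<^sub>R x + b) ` X \<in> conv_bodies"
proof -
  have X: "X \<in> conv_sets" using assms by (simp add: conv_bodies_def)
  obtain c r where r: "0 < r" "\<And>p. c \<bullet> p + r * norm p \<le> support_fun X p"
    using conv_bodies_obtain_cball[OF assms(1)] by metis
  show ?thesis
  proof (rule conv_bodies_if_support_fun_ge[OF conv_sets_homothety[OF X]])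
    show "0 < l * r" using r assms by simp
    show "(l *\<^sub>R c + b) \<bullet> p + l * r * norm p \<le> support_fun ((\<lambda>x. l *\<^sub>R x + b) ` X) p" for p
      using mult_left_mono[OF r(2)[of p], of l] assms(2)
      by (subst support_fun_homothety[OF X]) (simp_all add: inner_add_left algebra_simps)
  qed
qed

lemma abs_support_fun_le:
  assumes "X \<in> conv_sets" "\<And>x. x \<in> X \<Longrightarrow> norm x \<le> R"
  shows "\<bar>support_fun X p\<bar> \<le> R * norm p"
proof -
  obtain x where x: "x \<in> X" "support_fun X p = x \<bullet> p"
    using support_fun_attained[OF assms(1)] by metis
  have "\<bar>x \<bullet> p\<bar> \<le> norm x * norm p" by (rule Cauchy_Schwarz_ineq2)
  also have "\<dots> \<le> R * norm p" using assms(2)[OF x(1)] by (intro mult_right_mono) auto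
  finally show ?thesis using x(2) by simp
qed

section \<open>The Hausdorff distance in terms of support functions\<close>

lemma bdd_above_infdist_image:
  assumes "compact X"
  shows "bdd_above ((\<lambda>x. infdist x Y) ` X)"
  using assms
  by (intro bounded_imp_bdd_above compact_imp_bounded compact_continuous_image continuous_intros)

lemma infdist_le_hausdorff_dist:
  assumes "X \<in> conv_sets" "Y \<in> conv_sets"
  shows "x \<in> X \<Longrightarrow> infdist x Y \<le> hausdorff_dist X Y"
    and "y \<in> Y \<Longrightarrow> infdist y X \<le> hausdorff_dist X Y"
  unfolding hausdorff_dist_def using assms
  by (auto simp: conv_sets_def
      intro: max.coboundedI1[OF cSUP_upper] max.coboundedI2[OF cSUP_upper] bdd_above_infdist_image)

lemma hausdorff_dist_nonneg:
  assumes "X \<in> conv_sets" "Y \<in> conv_sets"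
  shows "0 \<le> hausdorff_dist X Y"
proof -
  obtain x where "x \<in> X" using assms by (auto simp: conv_sets_def)
  then show ?thesis using infdist_le_hausdorff_dist(1)[OF assms] infdist_nonneg[of x Y]
    by (meson order_trans)
qed

text \<open>Moving a maximiser \<open>x\<close> to its nearest point \<open>y\<close> in
  \<open>Y\<close> costs at most \<open>norm (x - y) * norm p\<close>.\<close>

lemma support_fun_le_if_infdist_le:
  assumes X: "X \<in> conv_sets" and Y: "Y \<in> conv_sets" and d: "\<And>x. x \<in> X \<Longrightarrow> infdist x Y \<le> d"
  shows "support_fun X p \<le> support_fun Y p + d * norm p"
proof -
  obtain x where x: "x \<in> X" "support_fun X p = x \<bullet> p"
    using support_fun_attained[OF X] by metis
  obtain y where y: "y \<in> Y" "infdist x Y = dist x y"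
    using infdist_attains_inf[of Y x] Y by (auto simp: conv_sets_def compact_imp_closed)
  have "(x - y) \<bullet> p \<le> norm (x - y) * norm p" by (rule norm_cauchy_schwarz)
  also have "\<dots> \<le> d * norm p"
    using d[OF x(1)] y by (intro mult_right_mono) (auto simp: dist_norm)
  finally show ?thesis
    using inner_le_support_fun[OF Y y(1), of p] x(2) by (simp add: inner_diff_left)
qed

lemma abs_support_fun_diff_le_hausdorff_dist:
  assumes "X \<in> conv_sets" "Y \<in> conv_sets"
  shows "\<bar>support_fun X p - support_fun Y p\<bar> \<le> hausdorff_dist X Y * norm p"
  using support_fun_le_if_infdist_le[OF assms infdist_le_hausdorff_dist(1)[OF assms], of p]
    support_fun_le_if_infdist_le[OF assms(2,1) infdist_le_hausdorff_dist(2)[OF assms], of p]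
  by linarith

text \<open>It is enough to test \<open>p = x - y\<close> with \<open>y\<close> the point of
  \<open>Y\<close> closest to \<open>x\<close>: the obtuse angle property makes \<open>y\<close> a
  maximiser for this \<open>p\<close>, and the hypothesis reduces to
  \<open>norm p * norm p \<le> d * norm p\<close>.\<close>

lemma infdist_le_if_support_fun_le:
  assumes X: "X \<in> conv_sets" and Y: "Y \<in> conv_sets" and "0 \<le> d"
    and le: "\<And>p. support_fun X p \<le> support_fun Y p + d * norm p" and x: "x \<in> X"
  shows "infdist x Y \<le> d"
proof -
  define y where "y = closest_point Y x"
  define p where "p = x - y"
  have Y': "convex Y" "closed Y" "Y \<noteq> {}"
    using Y by (auto simp: conv_sets_def compact_imp_closed)
  have y: "y \<in> Y" using Y' by (simp add: y_def closest_point_in_set)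
  have "z \<bullet> p \<le> y \<bullet> p" if "z \<in> Y" for z
    using closest_point_dot[OF Y'(1,2) that, of x]
    by (simp add: p_def y_def inner_diff_right inner_commute)
  then have "support_fun Y p = y \<bullet> p" using y by (intro support_fun_eqI) auto
  then have "x \<bullet> p \<le> y \<bullet> p + d * norm p"
    using inner_le_support_fun[OF X x, of p] le[of p] by linarith
  then have "p \<bullet> p \<le> d * norm p" by (simp add: p_def inner_diff_left)
  then have "norm p * norm p \<le> d * norm p" by (simp add: dot_square_norm power2_eq_square)
  then have "norm p \<le> d" using \<open>0 \<le> d\<close> by (cases "p = 0") auto
  then show ?thesis using infdist_le[OF y, of x] by (simp add: p_def dist_norm)
qed

lemma hausdorff_dist_le_if_support_fun:
  assumes "X \<in> conv_sets" "Y \<in> conv_sets" "0 \<le> d"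
    and le: "\<And>p. \<bar>support_fun X p - support_fun Y p\<bar> \<le> d * norm p"
  shows "hausdorff_dist X Y \<le> d"
proof -
  have "infdist x Y \<le> d" if "x \<in> X" for x
    using assms that le by (intro infdist_le_if_support_fun_le[of X Y]) (auto simp: abs_le_iff algebra_simps)
  moreover have "infdist x X \<le> d" if "x \<in> Y" for x
    using assms that le by (intro infdist_le_if_support_fun_le[of Y X]) (auto simp: abs_le_iff algebra_simps)
  moreover have "X \<noteq> {}" "Y \<noteq> {}" using assms by (auto simp: conv_sets_def)
  ultimately show ?thesis
    unfolding hausdorff_dist_def by (auto intro!: cSUP_least)
qed

section \<open>The support function of a solution\<close>

text \<open>By additivity, a difference quotient of support functions is the support function of the
  scaled Hukuhara difference, so its distance to \<open>support_fun D p\<close> is at most the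
  Hausdorff distance times \<open>norm p\<close>. Restricting to \<open>{0..}\<close> covers the
  one-sided derivative at 0.\<close>

lemma has_hukuhara_derivative_support_fun:
  fixes X :: "real \<Rightarrow> 'a::euclidean_space set"
  assumes D: "has_hukuhara_derivative X D t" and X: "\<And>s. 0 \<le> s \<Longrightarrow> X s \<in> conv_sets" and t: "0 \<le> t"
  shows "((\<lambda>s. support_fun (X s) p) has_real_derivative support_fun D p) (at t within {0..})"
proof -
  define f where "f s = support_fun (X s) p" for s
  have DD: "D \<in> conv_sets" using D by (simp add: has_hukuhara_derivative_def)
  have key: "\<bar>(support_fun U p - support_fun V p) / h - support_fun D p\<bar>
      \<le> hausdorff_dist ((*\<^sub>R) (inverse h) ` hukuhara_diff U V) D * norm p"
    if V: "V \<in> conv_sets" and ex: "hukuhara_diff_exists U V" and h: "0 < h" for U V h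
  proof -
    obtain Z where Z: "Z \<in> conv_sets" "U = V + Z" using ex by (auto simp: hukuhara_diff_exists_def)
    have eq: "hukuhara_diff U V = Z" using V Z by (rule hukuhara_diff_eq)
    have "(support_fun U p - support_fun V p) / h = support_fun ((*\<^sub>R) (inverse h) ` Z) p"
      using h by (simp add: Z(2) support_fun_plus[OF V Z(1)] support_fun_scaleR[OF Z(1)] field_simps)
    then show ?thesis
      using abs_support_fun_diff_le_hausdorff_dist[OF conv_sets_scaleR[OF Z(1)] DD] by (simp add: eq)
  qed
  \<comment> \<open>Keeping \<open>U\<close> and \<open>V\<close> general serves both the forward
    and the backward quotient.\<close>
  have lim: "((\<lambda>h. (support_fun (U h) p - support_fun (V h) p) / h) \<longlongrightarrow> support_fun D p) (at_right 0)"
    if "\<forall>\<^sub>F h in at_right 0. V h \<in> conv_sets"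
      "\<forall>\<^sub>F h in at_right 0. hukuhara_diff_exists (U h) (V h)"
      "((\<lambda>h. hausdorff_dist ((*\<^sub>R) (inverse h) ` hukuhara_diff (U h) (V h)) D) \<longlongrightarrow> 0) (at_right 0)"
    for U V
  proof -
    have "\<forall>\<^sub>F h in at_right 0. norm ((support_fun (U h) p - support_fun (V h) p) / h - support_fun D p)
      \<le> hausdorff_dist ((*\<^sub>R) (inverse h) ` hukuhara_diff (U h) (V h)) D * norm p"
      using that(1,2) eventually_at_right_less[of 0]
      by eventually_elim (use key in auto)
    moreover have "((\<lambda>h. hausdorff_dist ((*\<^sub>R) (inverse h) ` hukuhara_diff (U h) (V h)) D * norm p)
        \<longlongrightarrow> 0) (at_right 0)"
      using tendsto_mult_right[OF that(3), of "norm p"] by simp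
    ultimately show ?thesis by (rule Lim_null_comparison[THEN LIM_zero_cancel])
  qed
  have right: "((\<lambda>s. (f s - f t) / (s - t)) \<longlongrightarrow> support_fun D p) (at_right t)"
  proof -
    have "((\<lambda>h. (f (t + h) - f t) / h) \<longlongrightarrow> support_fun D p) (at_right 0)"
      unfolding f_def using D X t by (intro lim) (auto simp: has_hukuhara_derivative_def)
    then show ?thesis by (subst filterlim_at_right_to_0) (simp add: add.commute)
  qed
  have "((\<lambda>s. (f s - f t) / (s - t)) \<longlongrightarrow> support_fun D p) (at t within {0..})"
  proof (cases "t = 0")
    case True
    then show ?thesis using right by (simp add: at_within_Ici_at_right)
  next
    case False
    then have t: "0 < t" using t by simp
    have "\<forall>\<^sub>F h in at_right 0. h < t"
      using t by (simp add: eventually_at_right_field) (use t in blast)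
    then have "\<forall>\<^sub>F h in at_right 0. X (t - h) \<in> conv_sets"
      by eventually_elim (use X in auto)
    then have "((\<lambda>h. (f t - f (t - h)) / h) \<longlongrightarrow> support_fun D p) (at_right 0)"
      unfolding f_def using D t by (intro lim) (auto simp: has_hukuhara_derivative_def)
    \<comment> \<open>The term \<open>- (h + - t)\<close> is \<open>t - h\<close> in the shape
      produced by reflecting the left neighbourhood of \<open>t\<close> and shifting it to
      0.\<close>
    moreover have "(f t - f (t - h)) / h = (f (- (h + - t)) - f t) / (- (h + - t) - t)" for h
      by (simp add: divide_simps)
    ultimately have "((\<lambda>s. (f s - f t) / (s - t)) \<longlongrightarrow> support_fun D p) (at_left t)"
      by (simp add: filterlim_at_left_to_right filterlim_at_right_to_0[of _ _ "- t"])
    then have "((\<lambda>s. (f s - f t) / (s - t)) \<longlongrightarrow> support_fun D p) (at t)"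
      using right by (simp add: filterlim_at_split)
    then show ?thesis by (rule filterlim_mono) (auto simp: at_le)
  qed
  then show ?thesis by (simp add: has_field_derivative_iff f_def)
qed

lemma has_real_derivative_bound_from_0:
  fixes f g :: "real \<Rightarrow> real"
  assumes "\<And>s. 0 \<le> s \<Longrightarrow> s \<le> t \<Longrightarrow> (f has_real_derivative f' s) (at s within {0..})"
    and "\<And>s. 0 \<le> s \<Longrightarrow> s \<le> t \<Longrightarrow> (g has_real_derivative g' s) (at s within {0..})"
    and "\<And>s. 0 \<le> s \<Longrightarrow> s \<le> t \<Longrightarrow> f' s \<le> g' s" and "f 0 \<le> g 0" and "0 \<le> t"
  shows "f t \<le> g t"
proof -
  have d: "((\<lambda>s. g s - f s) has_real_derivative g' s - f' s) (at s within {0..})"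
    if "0 \<le> s" "s \<le> t" for s
    using assms(1,2) that by (intro DERIV_diff) auto
  have "g 0 - f 0 \<le> g t - f t"
  proof (rule DERIV_nonneg_imp_increasing_open[OF \<open>0 \<le> t\<close>])
    fix s assume s: "0 < s" "s < t"
    \<comment> \<open>Away from 0 the derivative is two-sided; at the endpoint 0 only continuity is
      used.\<close>
    then have "at s within {0..} = at s" by (intro at_within_interior) simp
    then show "\<exists>y. ((\<lambda>s. g s - f s) has_real_derivative y) (at s) \<and> 0 \<le> y"
      using d[of s] assms(3)[of s] s by auto
  next
    show "continuous_on {0..t} (\<lambda>s. g s - f s)"
      using d by (intro DERIV_continuous_on[of _ _ "\<lambda>s. g' s - f' s"])
        (auto intro: DERIV_subset[of _ _ _ "{0..}"])
  qed
  then show ?thesis using \<open>f 0 \<le> g 0\<close> by simp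
qed

text \<open>Here \<open>f k\<close> is the \<open>k\<close>-th derivative of \<open>f 0\<close>. A
  bound uniform in \<open>k\<close> makes the Taylor remainder at most
  \<open>C * t ^ N / fact N\<close>, which tends to 0.\<close>

lemma taylor_sums_iterated_derivative:
  fixes f :: "nat \<Rightarrow> real \<Rightarrow> real"
  assumes deriv: "\<And>k s. 0 \<le> s \<Longrightarrow> (f k has_real_derivative f (Suc k) s) (at s within {0..})"
    and bound: "\<And>k s. 0 \<le> s \<Longrightarrow> s \<le> t \<Longrightarrow> \<bar>f k s\<bar> \<le> C" and t: "0 \<le> t"
  shows "(\<lambda>k. t ^ k / fact k * f k 0) sums f 0 t"
proof -
  have pow: "((\<lambda>s. c * (s ^ Suc k / fact (Suc k))) has_real_derivative c * (s ^ k / fact k)) (at s within S)"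
    for c s :: real and k S
  proof -
    have "((\<lambda>s. c * (s ^ Suc k / fact (Suc k))) has_real_derivative
        c * (real (Suc k) * s ^ k / fact (Suc k))) (at s within S)"
      using DERIV_power[OF DERIV_ident, of "Suc k" s S]
      by (intro DERIV_cmult DERIV_cdivide) (simp del: of_nat_Suc)
    then show ?thesis by (simp add: fact_Suc del: of_nat_Suc)
  qed
  \<comment> \<open>Induction on \<open>N\<close> for all \<open>j\<close> at once: the derivative
    of the remainder of order \<open>Suc N\<close> of \<open>f j\<close> is the remainder of order
    \<open>N\<close> of \<open>f (Suc j)\<close>.\<close>
  have rem: "\<bar>f j s - (\<Sum>k<N. s ^ k / fact k * f (k + j) 0)\<bar> \<le> C * (s ^ N / fact N)"
    if "0 \<le> s" "s \<le> t" for N j s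
    using that
  proof (induction N arbitrary: j s)
    case 0
    then show ?case using bound by simp
  next
    case (Suc N)
    define r where "r s = f j s - (\<Sum>k<Suc N. s ^ k / fact k * f (k + j) 0)" for s
    define r' where "r' s = f (Suc j) s - (\<Sum>k<N. s ^ k / fact k * f (k + Suc j) 0)" for s
    \<comment> \<open>Splitting off the constant term lets termwise differentiation lower every
      remaining power by one.\<close>
    have r_eq: "r = (\<lambda>s. f j s - (f j 0 + (\<Sum>k<N. f (k + Suc j) 0 * (s ^ Suc k / fact (Suc k)))))"
      by (rule ext) (simp add: r_def sum.lessThan_Suc_shift mult.commute
          del: sum.lessThan_Suc fact_Suc power_Suc)
    have r_deriv: "(r has_real_derivative r' s) (at s within {0..})" if "0 \<le> s" for s
    proof -
      have "(r has_real_derivative f (Suc j) s - (0 + (\<Sum>k<N. f (k + Suc j) 0 * (s ^ k / fact k))))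
          (at s within {0..})"
        unfolding r_eq by (intro DERIV_diff DERIV_add DERIV_const DERIV_sum pow deriv that)
      then show ?thesis by (simp add: r'_def mult.commute)
    qed
    have IH: "\<bar>r' x\<bar> \<le> C * (x ^ N / fact N)" if "0 \<le> x" "x \<le> s" for x
      using Suc.IH[of x "Suc j"] Suc.prems that by (simp add: r'_def)
    have r0: "r 0 = 0" by (simp add: r_eq)
    \<comment> \<open>Comparing both \<open>r\<close> and \<open>- r\<close> with the integrated
      bound gives the estimate of the absolute value.\<close>
    have "r s \<le> C * (s ^ Suc N / fact (Suc N))"
      by (rule has_real_derivative_bound_from_0[where f' = r' and g' = "\<lambda>x. C * (x ^ N / fact N)"])
        (use r_deriv pow IH r0 Suc.prems in \<open>auto simp: abs_le_iff simp del: power_Suc fact_Suc\<close>)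
    moreover have "- r s \<le> C * (s ^ Suc N / fact (Suc N))"
      by (rule has_real_derivative_bound_from_0[where f' = "\<lambda>x. - r' x" and g' = "\<lambda>x. C * (x ^ N / fact N)"])
        (use DERIV_minus[OF r_deriv] pow IH r0 Suc.prems in \<open>auto simp: abs_le_iff simp del: power_Suc fact_Suc\<close>)
    ultimately show ?case unfolding r_def by linarith
  qed
  have "(\<lambda>N. t ^ N / fact N) \<longlonglongrightarrow> 0"
    using summable_LIMSEQ_zero[OF summable_exp[of t]] by (simp add: field_simps)
  then have "(\<lambda>N. C * (t ^ N / fact N)) \<longlonglongrightarrow> 0"
    using tendsto_mult_right_zero by blast
  then have "(\<lambda>N. f 0 t - (\<Sum>k<N. t ^ k / fact k * f k 0)) \<longlonglongrightarrow> 0"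
    by (rule Lim_null_comparison[rotated]) (use rem[of t 0] t in \<open>simp add: always_eventually\<close>)
  then have "(\<lambda>N. f 0 t - (f 0 t - (\<Sum>k<N. t ^ k / fact k * f k 0))) \<longlonglongrightarrow> f 0 t - 0"
    by (intro tendsto_diff tendsto_const)
  then show ?thesis by (simp add: sums_def)
qed

text \<open>The derivative is again a value of the same support function, at
  \<open>adjoint A p\<close>, so all higher derivatives come from iterating
  \<open>adjoint A\<close>.\<close>

lemma solution_support_fun_deriv:
  assumes "solves_set_ode A X\<^sub>0 X" "linear A" "0 \<le> t"
  shows "((\<lambda>s. support_fun (X s) p) has_real_derivative support_fun (X t) (adjoint A p))
    (at t within {0..})"
proof -
  have X: "\<And>s. 0 \<le> s \<Longrightarrow> X s \<in> conv_sets" "has_hukuhara_derivative X (A ` X t) t"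
    using assms by (auto simp: solves_set_ode_def)
  show ?thesis
    using has_hukuhara_derivative_support_fun[OF X(2,1) assms(3), of p]
    by (simp add: support_fun_linear_image[OF X(1)[OF assms(3)] assms(2)])
qed

text \<open>Differentiability gives continuity in time for each fixed \<open>p\<close>. Finitely
  many directions already control the size of \<open>X s\<close>, which makes the bound uniform in
  \<open>p\<close>.\<close>

lemma solution_support_fun_locally_bounded:
  fixes A :: "'a::euclidean_space \<Rightarrow> 'a"
  assumes sol: "solves_set_ode A X\<^sub>0 X" and A: "linear A"
  obtains C where "\<And>s p. 0 \<le> s \<Longrightarrow> s \<le> t \<Longrightarrow> \<bar>support_fun (X s) p\<bar> \<le> C * norm p"
proof -
  \<comment> \<open>The values at \<open>i\<close> and \<open>- i\<close> bound the coordinate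
    \<open>x \<bullet> i\<close> of every point \<open>x\<close> from both sides.\<close>
  define F where "F s = (\<Sum>i\<in>Basis. \<bar>support_fun (X s) i\<bar> + \<bar>support_fun (X s) (- i)\<bar>)" for s
  have "continuous_on {0..t} (\<lambda>s. support_fun (X s) p)" for p
    by (rule DERIV_continuous_on[of _ _ "\<lambda>s. support_fun (X s) (adjoint A p)"])
      (auto intro: DERIV_subset[OF solution_support_fun_deriv[OF sol A]])
  then have "continuous_on {0..t} F" unfolding F_def by (intro continuous_intros)
  then have "bounded (F ` {0..t})" by (intro compact_imp_bounded compact_continuous_image) auto
  then obtain C where C: "\<And>s. 0 \<le> s \<Longrightarrow> s \<le> t \<Longrightarrow> \<bar>F s\<bar> \<le> C"
    by (fastforce simp: bounded_iff)
  show thesis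
  proof (rule that)
    fix s p assume s: "0 \<le> s" "s \<le> t"
    have X: "X s \<in> conv_sets" using sol s by (auto simp: solves_set_ode_def)
    show "\<bar>support_fun (X s) p\<bar> \<le> C * norm p"
    proof (rule abs_support_fun_le[OF X])
      fix x assume x: "x \<in> X s"
      have "norm x \<le> (\<Sum>i\<in>Basis. \<bar>x \<bullet> i\<bar>)" by (rule norm_le_l1)
      also have "\<dots> \<le> F s"
        unfolding F_def
      proof (rule sum_mono)
        fix i :: 'a
        show "\<bar>x \<bullet> i\<bar> \<le> \<bar>support_fun (X s) i\<bar> + \<bar>support_fun (X s) (- i)\<bar>"
          using inner_le_support_fun[OF X x, of i] inner_le_support_fun[OF X x, of "- i"]
          by (simp add: inner_minus_right)
      qed
      finally show "norm x \<le> C" using C[OF s] by linarith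
    qed
  qed
qed

text \<open>The Taylor lemma applies to \<open>support_fun (X s) ((adjoint A ^^ k) p)\<close>; power
  boundedness supplies a bound independent of \<open>k\<close>.\<close>

lemma solution_support_fun_sums:
  fixes A :: "'a::euclidean_space \<Rightarrow> 'a"
  assumes sol: "solves_set_ode A X\<^sub>0 X" and A: "linear A" and t: "0 \<le> t"
    and M: "\<And>k p. norm ((adjoint A ^^ k) p) \<le> M * norm p"
  shows "(\<lambda>k. t ^ k / fact k * support_fun X\<^sub>0 ((adjoint A ^^ k) p)) sums support_fun (X t) p"
proof -
  obtain C where C: "\<And>s p. 0 \<le> s \<Longrightarrow> s \<le> t \<Longrightarrow> \<bar>support_fun (X s) p\<bar> \<le> C * norm p"
    using solution_support_fun_locally_bounded[OF sol A] by metis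
  have b: "\<bar>support_fun (X s) ((adjoint A ^^ k) p)\<bar> \<le> \<bar>C\<bar> * (M * norm p)" if "0 \<le> s" "s \<le> t" for s k
  proof -
    have "C * norm ((adjoint A ^^ k) p) \<le> \<bar>C\<bar> * (M * norm p)"
      using M by (intro mult_mono) auto
    then show ?thesis using C[OF that, of "(adjoint A ^^ k) p"] by linarith
  qed
  have "(\<lambda>k. t ^ k / fact k * support_fun (X 0) ((adjoint A ^^ k) p)) sums
      support_fun (X t) ((adjoint A ^^ 0) p)"
    using taylor_sums_iterated_derivative[where f = "\<lambda>k s. support_fun (X s) ((adjoint A ^^ k) p)",
      OF _ b t] solution_support_fun_deriv[OF sol A] by simp
  moreover have "X 0 = X\<^sub>0" using sol by (simp add: solves_set_ode_def)
  ultimately show ?thesis by simp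
qed

section \<open>Comparison of shapes\<close>

text \<open>The normalising factor of \<open>unit_volume\<close>. It is homogeneous of degree one
  under dilations and so compares linearly with the inradius.\<close>

definition vol_root :: "'a::euclidean_space set \<Rightarrow> real" where
  "vol_root X = root DIM('a) (measure lebesgue X)"

lemma unit_volume_eq: "unit_volume X = (*\<^sub>R) (inverse (vol_root X)) ` X"
  by (simp add: unit_volume_def vol_root_def)

lemma vol_root_pos: "X \<in> conv_bodies \<Longrightarrow> 0 < vol_root X"
  using conv_bodies_measure_pos[of X] by (simp add: vol_root_def)

lemma vol_root_homothety:
  fixes X :: "'a::euclidean_space set"
  assumes "0 \<le> l"
  shows "vol_root ((\<lambda>x. l *\<^sub>R x + b) ` X) = l * vol_root X"
proof -
  have "measure lebesgue ((\<lambda>x. l *\<^sub>R x + b) ` X) = l ^ DIM('a) * measure lebesgue X"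
    using measure_lebesgue_affine[of l b X] assms by (simp add: add.commute)
  then show ?thesis
    using assms by (simp add: real_root_mult real_root_power_cancel vol_root_def)
qed

lemma vol_root_mono:
  assumes "X \<in> conv_sets" "Y \<in> conv_sets" "X \<subseteq> Y"
  shows "vol_root X \<le> vol_root Y"
proof -
  have "X \<in> lmeasurable" "Y \<in> lmeasurable"
    using assms by (auto simp: conv_sets_def lmeasurable_compact)
  then have "measure lebesgue X \<le> measure lebesgue Y"
    using assms(3) by (intro measure_mono_fmeasurable) auto
  then show ?thesis by (simp add: vol_root_def)
qed

lemma vol_root_ge_inradius:
  fixes X :: "'a::euclidean_space set"
  assumes "X \<in> conv_sets" "0 \<le> r" "\<And>p. c \<bullet> p + r * norm p \<le> support_fun X p"
  shows "r * vol_root (cball 0 1 :: 'a set) \<le> vol_root X"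
proof -
  have "(\<lambda>x. r *\<^sub>R x + c) ` cball (0::'a) 1 \<subseteq> cball c r"
    using assms(2) by (auto simp: dist_norm mult_left_le)
  also have "\<dots> \<subseteq> X" using assms by (rule cball_subset_if_support_fun_ge)
  finally have "vol_root ((\<lambda>x. r *\<^sub>R x + c) ` cball (0::'a) 1) \<le> vol_root X"
    using assms(1) by (intro vol_root_mono conv_sets_homothety cball_in_conv_sets) auto
  then show ?thesis using assms(2) by (simp add: vol_root_homothety)
qed

text \<open>As \<open>Z\<close> contains the ball of radius \<open>\<rho>\<close> about \<open>c\<close>, enlarging \<open>Z\<close> by \<open>d\<close> yields no more
  than dilating it by the factor \<open>1 + d / \<rho>\<close> about \<open>c\<close>.\<close>

lemma vol_root_le_dilation:
  fixes Y Z :: "'a::euclidean_space set"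
  assumes Y: "Y \<in> conv_sets" and Z: "Z \<in> conv_sets" and \<rho>: "0 < \<rho>" and d: "0 \<le> d"
    and inner: "\<And>p. c \<bullet> p + \<rho> * norm p \<le> support_fun Z p"
    and le: "\<And>p. support_fun Y p \<le> support_fun Z p + d * norm p"
  shows "vol_root Y \<le> (1 + d / \<rho>) * vol_root Z"
proof -
  define l where "l = 1 + d / \<rho>"
  have l: "0 \<le> l" using \<rho> d by (simp add: l_def)
  \<comment> \<open>The translation is chosen so that the dilation by \<open>l\<close> fixes
    \<open>c\<close>.\<close>
  let ?W = "(\<lambda>x. l *\<^sub>R x + - (d / \<rho>) *\<^sub>R c) ` Z"
  have "Y \<subseteq> ?W"
  proof (rule subset_if_support_fun_le[OF Y conv_sets_homothety[OF Z]])
    fix p :: 'a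
    have "d * norm p = (d / \<rho>) * (\<rho> * norm p)" using \<rho> by simp
    also have "\<dots> \<le> (d / \<rho>) * (support_fun Z p - c \<bullet> p)"
      using inner[of p] \<rho> d by (intro mult_left_mono) auto
    finally have "support_fun Y p \<le> support_fun Z p + (d / \<rho>) * (support_fun Z p - c \<bullet> p)"
      using le[of p] by linarith
    then show "support_fun Y p \<le> support_fun ?W p"
      unfolding support_fun_homothety[OF Z l] by (simp add: l_def algebra_simps)
  qed
  then have "vol_root Y \<le> vol_root ?W" by (intro vol_root_mono Y conv_sets_homothety Z)
  then show ?thesis unfolding vol_root_homothety[OF l] by (simp add: l_def)
qed

section \<open>Shape distance versus support functions\<close>

lemma bdd_below_hausdorff_dist_translates:
  assumes "X \<in> conv_sets" "Y \<in> conv_sets"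
  shows "bdd_below (range (\<lambda>x. hausdorff_dist X ((\<lambda>y. y + x) ` Y)))"
  using assms conv_sets_homothety[of Y 1] by (intro bdd_belowI2[of _ 0] hausdorff_dist_nonneg) auto

lemma support_fun_translated_unit_volume:
  assumes "X \<in> conv_bodies"
  shows "(\<lambda>y. y + x) ` unit_volume X \<in> conv_sets"
    and "support_fun ((\<lambda>y. y + x) ` unit_volume X) p = support_fun X p / vol_root X + x \<bullet> p"
proof -
  have eq: "(\<lambda>y. y + x) ` unit_volume X = (\<lambda>y. inverse (vol_root X) *\<^sub>R y + x) ` X"
    by (simp add: unit_volume_eq image_image)
  have X: "X \<in> conv_sets" using assms by (simp add: conv_bodies_def)
  show "(\<lambda>y. y + x) ` unit_volume X \<in> conv_sets"
    unfolding eq by (rule conv_sets_homothety[OF X])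
  show "support_fun ((\<lambda>y. y + x) ` unit_volume X) p = support_fun X p / vol_root X + x \<bullet> p"
    unfolding eq using vol_root_pos[OF assms]
    by (subst support_fun_homothety[OF X]) (auto simp: field_simps)
qed

lemma support_fun_unit_volume:
  assumes "X \<in> conv_bodies"
  shows "unit_volume X \<in> conv_sets"
    and "support_fun (unit_volume X) p = support_fun X p / vol_root X"
  using support_fun_translated_unit_volume[OF assms, of 0] by auto

text \<open>An infimum below \<open>\<delta>\<close> yields a good translate of the normalised
  bodies; multiplying by \<open>vol_root X\<close> undoes the normalisation of \<open>X\<close> and
  leaves a homothetic copy of \<open>Y\<close>.\<close>

lemma body_shape_dist_less_imp_support_fun:
  fixes X Y :: "'a::euclidean_space set"
  assumes X: "X \<in> conv_bodies" and Y: "Y \<in> conv_bodies" and less: "body_shape_dist X Y < \<delta>"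
  obtains x where "\<And>p. \<bar>support_fun X p - (vol_root X / vol_root Y * support_fun Y p + x \<bullet> p)\<bar>
    \<le> vol_root X * \<delta> * norm p"
proof -
  obtain x where x: "hausdorff_dist (unit_volume X) ((\<lambda>y. y + x) ` unit_volume Y) < \<delta>"
    using cInf_lessD[OF _ less[unfolded body_shape_dist_def]] by auto
  have u: "0 < vol_root X" by (rule vol_root_pos[OF X])
  show thesis
  proof (rule that)
    fix p
    have "\<bar>support_fun X p / vol_root X - (support_fun Y p / vol_root Y + x \<bullet> p)\<bar>
        \<le> hausdorff_dist (unit_volume X) ((\<lambda>y. y + x) ` unit_volume Y) * norm p"
      using abs_support_fun_diff_le_hausdorff_dist[OF support_fun_unit_volume(1)[OF X]
          support_fun_translated_unit_volume(1)[OF Y, of x], of p]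
      by (simp only: support_fun_unit_volume[OF X] support_fun_translated_unit_volume[OF Y])
    also have "\<dots> \<le> \<delta> * norm p" using x by (intro mult_right_mono) auto
    finally have "vol_root X * \<bar>support_fun X p / vol_root X - (support_fun Y p / vol_root Y + x \<bullet> p)\<bar>
        \<le> vol_root X * (\<delta> * norm p)"
      using u by (intro mult_left_mono) auto
    moreover have "vol_root X * \<bar>support_fun X p / vol_root X - (support_fun Y p / vol_root Y + x \<bullet> p)\<bar> =
        \<bar>vol_root X * (support_fun X p / vol_root X - (support_fun Y p / vol_root Y + x \<bullet> p))\<bar>"
      using u by (simp add: abs_mult)
    moreover have "vol_root X * (support_fun X p / vol_root X - (support_fun Y p / vol_root Y + x \<bullet> p)) =
        support_fun X p - (vol_root X / vol_root Y * support_fun Y p + (vol_root X *\<^sub>R x) \<bullet> p)"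
      using u by (simp add: field_simps)
    ultimately show "\<bar>support_fun X p - (vol_root X / vol_root Y * support_fun Y p + (vol_root X *\<^sub>R x) \<bullet> p)\<bar>
        \<le> vol_root X * \<delta> * norm p" by (simp add: mult.assoc)
  qed
qed

text \<open>The error has two sources: the distance \<open>d\<close> of the bodies and the
  discrepancy of their volume roots, itself controlled by dilation about the inscribed ball. The
  bound depends only on the ratios \<open>d / \<rho>\<close> and \<open>R / \<rho>\<close>, so a
  common scale factor drops out.\<close>

lemma body_shape_dist_le:
  fixes Y Z :: "'a::euclidean_space set"
  assumes Y: "Y \<in> conv_bodies" and Z: "Z \<in> conv_bodies" and \<rho>: "0 < \<rho>" and d: "0 \<le> d" "d \<le> \<rho> / 2"
    and inner: "\<And>p. c \<bullet> p + \<rho> * norm p \<le> support_fun Z p"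
    and outer: "\<And>p. \<bar>support_fun Z p - b \<bullet> p\<bar> \<le> R * norm p"
    and close: "\<And>p. \<bar>support_fun Y p - support_fun Z p\<bar> \<le> d * norm p"
  shows "body_shape_dist Y Z \<le> 2 / vol_root (cball 0 1 :: 'a set) * (d / \<rho>) * (1 + R / \<rho>)"
proof -
  define \<omega> where "\<omega> = vol_root (cball 0 1 :: 'a set)"
  define u where "u = vol_root Y"
  define w where "w = vol_root Z"
  have Y': "Y \<in> conv_sets" and Z': "Z \<in> conv_sets" using Y Z by (auto simp: conv_bodies_def)
  have \<omega>: "0 < \<omega>" unfolding \<omega>_def
    by (intro vol_root_pos) (simp add: conv_bodies_def cball_in_conv_sets)
  have u: "0 < u" and w: "0 < w" using vol_root_pos Y Z by (auto simp: u_def w_def)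
  \<comment> \<open>As \<open>d\<close> is at most \<open>\<rho> / 2\<close>, \<open>Y\<close> keeps
    a ball of half the radius about the same centre.\<close>
  have innerY: "c \<bullet> p + (\<rho> / 2) * norm p \<le> support_fun Y p" for p
  proof -
    have "d * norm p \<le> (\<rho> / 2) * norm p" using d by (intro mult_right_mono) auto
    then show ?thesis using inner[of p] close[of p] by (simp add: abs_le_iff)
  qed
  have w_ge: "\<rho> * \<omega> \<le> w" unfolding \<omega>_def w_def
    using Z' \<rho> inner by (intro vol_root_ge_inradius) auto
  have u_ge: "\<rho> / 2 * \<omega> \<le> u" unfolding \<omega>_def u_def
    using Y' \<rho> innerY by (intro vol_root_ge_inradius) auto
  have "u \<le> (1 + d / \<rho>) * w" unfolding u_def w_def
    using close by (intro vol_root_le_dilation[OF Y' Z' \<rho> d(1) inner]) (auto simp: abs_le_iff algebra_simps)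
  then have uw: "(u - w) / w \<le> d / \<rho>" using w by (simp add: field_simps)
  have "w \<le> (1 + d / (\<rho> / 2)) * u" unfolding u_def w_def
    using close \<rho> by (intro vol_root_le_dilation[OF Z' Y' _ d(1) innerY]) (auto simp: abs_le_iff algebra_simps)
  then have wu: "(w - u) / u \<le> 2 * (d / \<rho>)" using u \<rho> by (simp add: field_simps)
  \<comment> \<open>The relative error is taken over the smaller volume root and the other one is
    bounded below by its inscribed ball; the weaker constant falls on opposite factors in the two
    cases, so both give the same bound.\<close>
  have inv: "\<bar>1 / u - 1 / w\<bar> \<le> 2 * (d / \<rho>) / (\<rho> * \<omega>)"
  proof (cases "u \<le> w")
    case True
    then have "\<bar>1 / u - 1 / w\<bar> = (w - u) / u / w" using u w by (simp add: field_simps)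
    also have "\<dots> \<le> 2 * (d / \<rho>) / (\<rho> * \<omega>)"
      using wu w_ge u w \<rho> \<omega> d by (intro frac_le[OF _ wu]) auto
    finally show ?thesis .
  next
    case False
    then have "\<bar>1 / u - 1 / w\<bar> = (u - w) / w / u" using u w by (simp add: field_simps)
    also have "\<dots> \<le> (d / \<rho>) / (\<rho> / 2 * \<omega>)"
      using u_ge u w \<rho> \<omega> d by (intro frac_le[OF _ uw]) auto
    also have "\<dots> = 2 * (d / \<rho>) / (\<rho> * \<omega>)" by simp
    finally show ?thesis .
  qed
  \<comment> \<open>This translate cancels the mismatch of \<open>b / u\<close> and
    \<open>b / w\<close>, so that only the size of \<open>Z\<close> about \<open>b\<close>
    enters.\<close>
  define x where "x = (1 / u - 1 / w) *\<^sub>R b"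
  define K where "K = 2 / \<omega> * (d / \<rho>) * (1 + R / \<rho>)"
  have R: "0 \<le> R"
  proof -
    obtain e :: 'a where "e \<in> Basis" using nonempty_Basis by blast
    then show ?thesis using outer[of e] by simp
  qed
  have K: "0 \<le> K" using R d \<rho> \<omega> by (simp add: K_def)
  have "hausdorff_dist (unit_volume Y) ((\<lambda>y. y + x) ` unit_volume Z) \<le> K"
  proof (rule hausdorff_dist_le_if_support_fun[OF support_fun_unit_volume(1)[OF Y]
        support_fun_translated_unit_volume(1)[OF Z] K])
    fix p
    have "support_fun (unit_volume Y) p - support_fun ((\<lambda>y. y + x) ` unit_volume Z) p =
        support_fun Y p / u - (support_fun Z p / w + x \<bullet> p)"
      by (simp only: support_fun_unit_volume[OF Y] support_fun_translated_unit_volume[OF Z] u_def w_def)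
    also have "\<dots> = (support_fun Y p - support_fun Z p) / u + (1 / u - 1 / w) * (support_fun Z p - b \<bullet> p)"
      by (simp add: x_def algebra_simps diff_divide_distrib)
    also have "\<bar>\<dots>\<bar> \<le> \<bar>support_fun Y p - support_fun Z p\<bar> / u + \<bar>1 / u - 1 / w\<bar> * \<bar>support_fun Z p - b \<bullet> p\<bar>"
      using u by (intro order_trans[OF abs_triangle_ineq]) (simp add: abs_mult abs_divide)
    also have "\<dots> \<le> d * norm p / (\<rho> / 2 * \<omega>) + 2 * (d / \<rho>) / (\<rho> * \<omega>) * (R * norm p)"
      using close outer inv u_ge \<rho> \<omega> d by (intro add_mono frac_le mult_mono) auto
    also have "\<dots> = K * norm p"
      using \<rho> \<omega> by (simp add: K_def field_simps)
    finally show "\<bar>support_fun (unit_volume Y) p - support_fun ((\<lambda>y. y + x) ` unit_volume Z) p\<bar> \<le> K * norm p" .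
  qed
  moreover have "body_shape_dist Y Z \<le> hausdorff_dist (unit_volume Y) ((\<lambda>y. y + x) ` unit_volume Z)"
    unfolding body_shape_dist_def
    by (intro cINF_lower bdd_below_hausdorff_dist_translates support_fun_unit_volume Y Z) simp
  ultimately show ?thesis unfolding K_def \<omega>_def by linarith
qed

text \<open>Homotheties are closed under composition and inverse. This allows a body to be replaced
  by a homothetic copy close to another body.\<close>

lemma homothety_orbit_homothety:
  assumes "0 < l"
  shows "homothety_orbit ((\<lambda>x. l *\<^sub>R x + b) ` X) = homothety_orbit X"
proof (intro antisym subsetI)
  fix W assume "W \<in> homothety_orbit ((\<lambda>x. l *\<^sub>R x + b) ` X)"
  then obtain m a where m: "0 < m" "W = (\<lambda>x. m *\<^sub>R x + a) ` (\<lambda>x. l *\<^sub>R x + b) ` X"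
    by (auto simp: homothety_orbit_def homotheties_def)
  then have "W = (\<lambda>x. (m * l) *\<^sub>R x + (m *\<^sub>R b + a)) ` X" "0 < m * l"
    using assms by (auto simp: image_image algebra_simps)
  then show "W \<in> homothety_orbit X" unfolding homothety_orbit_def homotheties_def by blast
next
  fix W assume "W \<in> homothety_orbit X"
  then obtain m a where m: "0 < m" "W = (\<lambda>x. m *\<^sub>R x + a) ` X"
    by (auto simp: homothety_orbit_def homotheties_def)
  then have "W = (\<lambda>x. (m / l) *\<^sub>R x + (a - (m / l) *\<^sub>R b)) ` (\<lambda>x. l *\<^sub>R x + b) ` X" "0 < m / l"
    using assms by (auto simp: image_image algebra_simps)
  then show "W \<in> homothety_orbit ((\<lambda>x. l *\<^sub>R x + b) ` X)"
    unfolding homothety_orbit_def homotheties_def by blast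
qed

section \<open>Power-bounded operators\<close>

lemma linear_funpow: "linear A \<Longrightarrow> linear (A ^^ k)"
  for A :: "'a::real_vector \<Rightarrow> 'a"
  by (induction k) (auto intro: linear_compose linear_id)

lemma inner_funpow_adjoint:
  fixes A :: "'a::euclidean_space \<Rightarrow> 'a"
  assumes "linear A"
  shows "(A ^^ k) x \<bullet> p = x \<bullet> (adjoint A ^^ k) p"
proof (induction k arbitrary: x)
  case (Suc k)
  have "(A ^^ Suc k) x \<bullet> p = (A ^^ k) (A x) \<bullet> p" by (simp add: funpow_swap1)
  also have "\<dots> = A x \<bullet> (adjoint A ^^ k) p" by (rule Suc.IH)
  finally show ?case by (simp add: adjoint_works[OF assms])
qed simp

text \<open>The upper bound passes to the adjoint by duality. The lower bound comes from negative
  powers, by pairing \<open>(inv A ^^ k) p\<close> with \<open>(adjoint A ^^ k) p\<close>; it keeps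
  inradii from degenerating.\<close>

lemma power_bounded_norm_bounds:
  fixes A :: "'a::euclidean_space \<Rightarrow> 'a"
  assumes A: "linear A" and bij: "bij A"
    and bdd: "bdd_above (range (\<lambda>k::int. onorm (int_power A k)))"
  obtains M where "1 \<le> M" "\<And>k x. norm ((A ^^ k) x) \<le> M * norm x"
    "\<And>k p. norm ((adjoint A ^^ k) p) \<le> M * norm p"
    "\<And>k p. norm p \<le> M * norm ((adjoint A ^^ k) p)"
proof -
  obtain M0 where M0: "\<And>k. onorm (int_power A k) \<le> M0" using bdd by (auto simp: bdd_above_def)
  define M where "M = max 1 M0"
  have *: "norm (f x) \<le> M * norm x" if "linear f" "onorm f \<le> M0" for f :: "'a \<Rightarrow> 'a" and x
  proof -
    have "norm (f x) \<le> onorm f * norm x"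
      using that(1) by (intro onorm) (simp add: linear_conv_bounded_linear)
    also have "\<dots> \<le> M * norm x" using that(2) by (intro mult_right_mono) (auto simp: M_def)
    finally show ?thesis .
  qed
  have linv: "linear (inv A)"
    using A bij by (simp add: bij_def linear_injective_imp_surjective inj_linear_imp_inv_linear)
  have pow: "norm ((A ^^ k) x) \<le> M * norm x" for k x
    using M0[of "int k"] by (intro * linear_funpow A) (simp add: int_power_def)
  have ipow: "norm ((inv A ^^ k) x) \<le> M * norm x" for k x
  \<comment> \<open>Only for positive \<open>k\<close> does \<open>int_power A (- int k)\<close>
    take the branch with \<open>inv A\<close>.\<close>
  proof (cases "k = 0")
    case False
    then show ?thesis using M0[of "- int k"] by (intro * linear_funpow linv) (simp add: int_power_def)
  qed (use pow[of 0] in simp)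
  have cancel: "(A ^^ k) ((inv A ^^ k) x) = x" for k x
    using bij by (metis bij_is_surj surj_fn bij_fn inv_fn surj_f_inv_f)
  have sq: "norm q \<le> C" if "norm q * norm q \<le> C * norm q" "0 \<le> C" for q :: 'a and C
    using that by (cases "q = 0") auto
  have M: "1 \<le> M" by (simp add: M_def)
  show thesis
  proof (rule that[OF M pow])
    fix k p
    let ?q = "(adjoint A ^^ k) p"
    have "norm ?q * norm ?q = (A ^^ k) ?q \<bullet> p"
      by (simp add: inner_funpow_adjoint[OF A] dot_square_norm power2_eq_square)
    also have "\<dots> \<le> norm ((A ^^ k) ?q) * norm p" by (rule norm_cauchy_schwarz)
    also have "\<dots> \<le> (M * norm ?q) * norm p" by (intro mult_right_mono pow) auto
    finally show "norm ?q \<le> M * norm p" using M by (intro sq) (auto simp: mult_ac)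
    have "norm p * norm p = (A ^^ k) ((inv A ^^ k) p) \<bullet> p"
      by (simp add: cancel dot_square_norm power2_eq_square)
    also have "\<dots> = (inv A ^^ k) p \<bullet> ?q" by (rule inner_funpow_adjoint[OF A])
    also have "\<dots> \<le> norm ((inv A ^^ k) p) * norm ?q" by (rule norm_cauchy_schwarz)
    also have "\<dots> \<le> (M * norm p) * norm ?q" by (intro mult_right_mono ipow) auto
    finally show "norm p \<le> M * norm ?q" using M by (intro sq) (auto simp: mult_ac)
  qed
qed

lemma exp_real_sums: "(\<lambda>k. t ^ k / fact k * c) sums (exp t * c)" for t c :: real
  using sums_mult2[OF exp_converges[of t], of c] by (simp add: field_simps)

text \<open>\<open>v\<close> is the value at \<open>b\<close> of the operator exponential of \<open>t A\<close>.\<close>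

lemma exp_operator_sums:
  fixes A :: "'a::euclidean_space \<Rightarrow> 'a"
  assumes A: "linear A" and t: "0 \<le> t" and M: "\<And>k x. norm ((A ^^ k) x) \<le> M * norm x"
  obtains v where "\<And>p. (\<lambda>k. t ^ k / fact k * (b \<bullet> (adjoint A ^^ k) p)) sums (v \<bullet> p)"
proof -
  have "summable (\<lambda>k. (t ^ k / fact k) *\<^sub>R (A ^^ k) b)"
  proof (rule summable_comparison_test)
    show "summable (\<lambda>k. t ^ k / fact k * (M * norm b))" using exp_real_sums sums_summable by blast
    show "\<exists>N. \<forall>k\<ge>N. norm ((t ^ k / fact k) *\<^sub>R (A ^^ k) b) \<le> t ^ k / fact k * (M * norm b)"
      using t M by (auto intro!: exI[of _ 0] divide_right_mono mult_left_mono)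
  qed
  then obtain v where v: "(\<lambda>k. (t ^ k / fact k) *\<^sub>R (A ^^ k) b) sums v" by (auto simp: summable_def)
  show thesis
  proof (rule that)
    fix p
    show "(\<lambda>k. t ^ k / fact k * (b \<bullet> (adjoint A ^^ k) p)) sums (v \<bullet> p)"
      using bounded_linear.sums[OF bounded_linear_inner_left v, of p]
      by (simp add: inner_funpow_adjoint[OF A])
  qed
qed

section \<open>Stability\<close>

theorem mainTheorem2:
  fixes A :: "real ^ 'n \<Rightarrow> real ^ 'n"
    and X\<^sub>0s :: "(real ^ 'n) set"
    and Xs :: "real \<Rightarrow> (real ^ 'n) set"
  assumes "linear A" and "bij A"
    and "bdd_above (range (\<lambda>k::int. onorm (int_power A k)))"
    and "X\<^sub>0s \<in> conv_sets" and "interior X\<^sub>0s \<noteq> {}"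
    and "solves_set_ode A X\<^sub>0s Xs"
  shows "\<forall>\<epsilon>>0. \<exists>\<delta>>0. \<forall>X\<^sub>0\<in>conv_bodies.
           shape_dist (homothety_orbit X\<^sub>0) (homothety_orbit X\<^sub>0s) < \<delta> \<longrightarrow>
           (\<forall>X. solves_set_ode A X\<^sub>0 X \<longrightarrow>
             (\<forall>t\<ge>0. shape_dist (homothety_orbit (X t)) (homothety_orbit (Xs t)) < \<epsilon>))"
proof (intro allI impI)
  fix \<epsilon> :: real assume \<epsilon>: "0 < \<epsilon>"
  note A = assms(1) and sols = assms(6)
  obtain M where M: "1 \<le> M" "\<And>k x. norm ((A ^^ k) x) \<le> M * norm x"
      "\<And>k p. norm ((adjoint A ^^ k) p) \<le> M * norm p"
      "\<And>k p. norm p \<le> M * norm ((adjoint A ^^ k) p)"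
    using power_bounded_norm_bounds[OF assms(1-3)] by metis
  have X0s: "X\<^sub>0s \<in> conv_bodies" using assms by (simp add: conv_bodies_def)
  have "bounded X\<^sub>0s" using assms by (simp add: conv_sets_def compact_imp_bounded)
  then obtain R where R: "0 < R" "\<And>x. x \<in> X\<^sub>0s \<Longrightarrow> norm x \<le> R" by (auto simp: bounded_pos)
  have h0s_le: "\<bar>support_fun X\<^sub>0s p\<bar> \<le> R * norm p" for p
    using assms(4) R(2) by (rule abs_support_fun_le)
  obtain c r where r: "0 < r" and h0s_ge: "\<And>p. c \<bullet> p + r * norm p \<le> support_fun X\<^sub>0s p"
    using conv_bodies_obtain_cball[OF X0s] by metis
  \<comment> \<open>Applied with \<open>q = (adjoint A ^^ k) p\<close>, this makes the radius term
    independent of \<open>k\<close>.\<close>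
  have sub: "a \<bullet> q + (s / M) * norm p \<le> y"
    if "a \<bullet> q + s * norm q \<le> y" "norm p \<le> M * norm q" "0 \<le> s" for a q p :: "real ^ 'n" and s y
  proof -
    have "(s / M) * norm p \<le> (s / M) * (M * norm q)" using that M(1) by (intro mult_left_mono) auto
    then show ?thesis using that M(1) by simp
  qed
  define \<omega> where "\<omega> = vol_root (cball 0 1 :: (real ^ 'n) set)"
  have \<omega>: "0 < \<omega>" unfolding \<omega>_def
    by (intro vol_root_pos) (simp add: conv_bodies_def cball_in_conv_sets)
  define w where "w = vol_root X\<^sub>0s"
  have w: "0 < w" unfolding w_def by (rule vol_root_pos[OF X0s])
  \<comment> \<open>\<open>K1\<close> is the ratio of \<open>d / \<rho>\<close> to
    \<open>\<delta>\<close> for the \<open>d\<close> and \<open>\<rho>\<close> below, and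
    \<open>\<delta> * K2\<close> is the final bound; neither constant involves \<open>t\<close> or
    the perturbed initial set.\<close>
  define K1 where "K1 = w * M\<^sup>2 / r"
  define K2 where "K2 = 2 / \<omega> * K1 * (1 + R * M\<^sup>2 / r)"
  have K: "0 < K1" "0 < K2"
  proof -
    show K1: "0 < K1" using w M(1) r by (simp add: K1_def)
    have "0 < 1 + R * M\<^sup>2 / r" using M(1) r R(1) by (intro add_pos_pos divide_pos_pos) auto
    then show "0 < K2" unfolding K2_def using K1 \<omega> by (intro mult_pos_pos) auto
  qed
  \<comment> \<open>The first entry secures \<open>d \<le> \<rho> / 2\<close>; the 2 in the second
    makes the final inequality strict.\<close>
  define \<delta> where "\<delta> = min (1 / (2 * K1)) (\<epsilon> / (2 * K2))"
  have \<delta>: "0 < \<delta>" "\<delta> * K1 \<le> 1 / 2" "\<delta> * K2 < \<epsilon>"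
  proof -
    show "0 < \<delta>" using K \<epsilon> by (simp add: \<delta>_def)
    have "\<delta> * K1 \<le> 1 / (2 * K1) * K1" using K by (intro mult_right_mono) (auto simp: \<delta>_def)
    then show "\<delta> * K1 \<le> 1 / 2" using K by simp
    have "\<delta> * K2 \<le> \<epsilon> / (2 * K2) * K2" using K by (intro mult_right_mono) (auto simp: \<delta>_def)
    then show "\<delta> * K2 < \<epsilon>" using K \<epsilon> by simp
  qed
  have "shape_dist (homothety_orbit (X t)) (homothety_orbit (Xs t)) < \<epsilon>"
    if X0: "X\<^sub>0 \<in> conv_bodies" and less: "shape_dist (homothety_orbit X\<^sub>0) (homothety_orbit X\<^sub>0s) < \<delta>"
      and sol: "solves_set_ode A X\<^sub>0 X" and t: "0 \<le> t" for X\<^sub>0 X t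
  proof -
    have Xt: "X t \<in> conv_sets" and Xst: "Xs t \<in> conv_sets"
      using sol sols t by (auto simp: solves_set_ode_def)
    define u where "u = vol_root X\<^sub>0"
    have u: "0 < u" unfolding u_def by (rule vol_root_pos[OF X0])
    define l where "l = u / w"
    have l: "0 < l" using u w by (simp add: l_def)
    have "body_shape_dist X\<^sub>0 X\<^sub>0s < \<delta>" using less by (simp add: shape_dist_orbit X0 X0s)
    then obtain b where b: "\<And>p. \<bar>support_fun X\<^sub>0 p - (l * support_fun X\<^sub>0s p + b \<bullet> p)\<bar> \<le> u * \<delta> * norm p"
      using body_shape_dist_less_imp_support_fun[OF X0 X0s, of \<delta>] unfolding l_def u_def w_def by metis
    \<comment> \<open>Translations and ball centres enter support functions linearly, so the
      exponential series carries \<open>b\<close> to a vector \<open>v\<close> and \<open>c\<close>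
      to a vector \<open>z\<close>.\<close>
    obtain v where v: "\<And>p. (\<lambda>k. t ^ k / fact k * (b \<bullet> (adjoint A ^^ k) p)) sums (v \<bullet> p)"
      using exp_operator_sums[OF A t M(2)] by metis
    obtain z where z: "\<And>p. (\<lambda>k. t ^ k / fact k * (c \<bullet> (adjoint A ^^ k) p)) sums (z \<bullet> p)"
      using exp_operator_sums[OF A t M(2)] by metis
    note S = solution_support_fun_sums[OF sol A t M(3)]
    note Ss = solution_support_fun_sums[OF sols A t M(3)]
    have term_nonneg: "0 \<le> t ^ k / fact k" for k using t by simp
    have hs_ge: "z \<bullet> p + exp t * (r / M) * norm p \<le> support_fun (Xs t) p" for p
    proof -
      have "(\<lambda>k. t ^ k / fact k * (c \<bullet> (adjoint A ^^ k) p + r / M * norm p))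
          sums (z \<bullet> p + exp t * (r / M * norm p))"
        using sums_add[OF z[of p] exp_real_sums[of t "r / M * norm p"]] by (simp add: distrib_left)
      moreover have "t ^ k / fact k * (c \<bullet> (adjoint A ^^ k) p + r / M * norm p)
          \<le> t ^ k / fact k * support_fun X\<^sub>0s ((adjoint A ^^ k) p)" for k
        using sub[OF h0s_ge M(4)] r by (intro mult_left_mono term_nonneg) auto
      ultimately have "z \<bullet> p + exp t * (r / M * norm p) \<le> support_fun (Xs t) p"
        by (rule sums_le[OF _ _ Ss, rotated])
      then show ?thesis by (simp add: mult.assoc)
    qed
    \<comment> \<open>Used with \<open>g\<close> the support function of \<open>X\<^sub>0s\<close>
      for the outer radius, and with \<open>g\<close> the initial discrepancy for closeness.\<close>
    have series_bound: "\<bar>y\<bar> \<le> exp t * (D * M) * norm p"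
      if "(\<lambda>k. t ^ k / fact k * g ((adjoint A ^^ k) p)) sums y" "\<And>q. \<bar>g q\<bar> \<le> D * norm q" "0 \<le> D"
      for g :: "real ^ 'n \<Rightarrow> real" and y D p
    proof -
      have gb: "\<bar>g ((adjoint A ^^ k) p)\<bar> \<le> D * M * norm p" for k
        using that(2)[of "(adjoint A ^^ k) p"] mult_left_mono[OF M(3)[of k p] that(3)]
        by (simp add: mult.assoc)
      have "t ^ k / fact k * g ((adjoint A ^^ k) p) \<le> t ^ k / fact k * (D * M * norm p)" for k
        using gb[of k] by (intro mult_left_mono term_nonneg) auto
      from sums_le[OF this that(1) exp_real_sums]
      have 1: "y \<le> exp t * (D * M * norm p)" .
      have "t ^ k / fact k * (- (D * M * norm p)) \<le> t ^ k / fact k * g ((adjoint A ^^ k) p)" for k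
        using gb[of k] by (intro mult_left_mono term_nonneg) auto
      from sums_le[OF this exp_real_sums that(1)]
      have "exp t * (- (D * M * norm p)) \<le> y" .
      with 1 show ?thesis by (simp add: abs_le_iff mult.assoc)
    qed
    have hs_le: "\<bar>support_fun (Xs t) p\<bar> \<le> exp t * (R * M) * norm p" for p
      using Ss h0s_le R(1) by (intro series_bound[where g = "support_fun X\<^sub>0s"]) auto
    have close: "\<bar>support_fun (X t) p - (l * support_fun (Xs t) p + v \<bullet> p)\<bar> \<le> exp t * (u * \<delta> * M) * norm p" for p
    proof (rule series_bound)
      show "(\<lambda>k. t ^ k / fact k * (support_fun X\<^sub>0 ((adjoint A ^^ k) p) -
          (l * support_fun X\<^sub>0s ((adjoint A ^^ k) p) + b \<bullet> (adjoint A ^^ k) p)))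
        sums (support_fun (X t) p - (l * support_fun (Xs t) p + v \<bullet> p))"
        using sums_diff[OF S[of p] sums_add[OF sums_mult[OF Ss[of p], of l] v[of p]]]
        by (simp add: algebra_simps)
    qed (use b u \<delta> in auto)
    have "0 < exp t * (r / M)" using r M(1) by simp
    then have Xsb: "Xs t \<in> conv_bodies" using hs_ge by (rule conv_bodies_if_support_fun_ge[OF Xst])
    \<comment> \<open>The homothetic copy of \<open>Xs t\<close> that shadows \<open>X t\<close>,
      with the ratio \<open>l\<close> fixed at time 0.\<close>
    define Z where "Z = (\<lambda>x. l *\<^sub>R x + v) ` Xs t"
    have Zb: "Z \<in> conv_bodies" unfolding Z_def using Xsb l by (rule conv_bodies_homothety)
    have hZ: "support_fun Z p = l * support_fun (Xs t) p + v \<bullet> p" for p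
      unfolding Z_def using Xst l by (intro support_fun_homothety) auto
    define \<rho> where "\<rho> = l * exp t * (r / M)"
    define d where "d = exp t * (u * \<delta> * M)"
    have \<rho>: "0 < \<rho>" using l r M(1) by (simp add: \<rho>_def)
    have d: "0 \<le> d" using u \<delta> M(1) by (simp add: d_def)
    \<comment> \<open>Both \<open>exp t\<close> and the size \<open>u\<close> of the perturbed
      initial set cancel, which makes the estimate uniform in time.\<close>
    have ratio: "d / \<rho> = \<delta> * K1"
      using u w r M(1) by (simp add: d_def \<rho>_def l_def K1_def field_simps power2_eq_square)
    have d2: "d \<le> \<rho> / 2" using \<delta>(2) \<rho> unfolding ratio[symmetric] by (simp add: field_simps)
    have Z_ge: "(l *\<^sub>R z + v) \<bullet> p + \<rho> * norm p \<le> support_fun Z p" for p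
      using mult_left_mono[OF hs_ge[of p], of l] l
      by (simp add: hZ \<rho>_def inner_add_left algebra_simps)
    have Z_le: "\<bar>support_fun Z p - v \<bullet> p\<bar> \<le> l * exp t * (R * M) * norm p" for p
      using mult_left_mono[OF hs_le[of p], of l] l by (simp add: hZ abs_mult mult.assoc)
    have XZ: "\<bar>support_fun (X t) p - support_fun Z p\<bar> \<le> d * norm p" for p
      using close[of p] by (simp add: hZ d_def)
    \<comment> \<open>Both sets must be convex bodies before \<open>shape_dist\<close> can be
      evaluated on representatives.\<close>
    have Xtb: "X t \<in> conv_bodies"
    proof (rule conv_bodies_if_support_fun_ge[OF Xt])
      show "0 < \<rho> / 2" using \<rho> by simp
      fix p :: "real ^ 'n"
      have "d * norm p \<le> \<rho> / 2 * norm p" using d2 by (intro mult_right_mono) auto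
      then show "(l *\<^sub>R z + v) \<bullet> p + \<rho> / 2 * norm p \<le> support_fun (X t) p"
        using Z_ge[of p] XZ[of p] by (simp add: abs_le_iff)
    qed
    have "shape_dist (homothety_orbit (X t)) (homothety_orbit (Xs t)) = body_shape_dist (X t) Z"
      using shape_dist_orbit[OF Xtb Zb] by (simp only: Z_def homothety_orbit_homothety[OF l])
    also have "\<dots> \<le> 2 / \<omega> * (d / \<rho>) * (1 + l * exp t * (R * M) / \<rho>)"
      unfolding \<omega>_def by (rule body_shape_dist_le[OF Xtb Zb \<rho> d d2 Z_ge Z_le XZ])
    also have "l * exp t * (R * M) / \<rho> = R * M\<^sup>2 / r"
      using l r M(1) by (simp add: \<rho>_def field_simps power2_eq_square)
    also have "2 / \<omega> * (d / \<rho>) * (1 + R * M\<^sup>2 / r) = \<delta> * K2"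
      by (simp add: ratio K2_def)
    finally show ?thesis using \<delta>(3) by linarith
  qed
  then show "\<exists>\<delta>>0. \<forall>X\<^sub>0\<in>conv_bodies.
           shape_dist (homothety_orbit X\<^sub>0) (homothety_orbit X\<^sub>0s) < \<delta> \<longrightarrow>
           (\<forall>X. solves_set_ode A X\<^sub>0 X \<longrightarrow>
             (\<forall>t\<ge>0. shape_dist (homothety_orbit (X t)) (homothety_orbit (Xs t)) < \<epsilon>))"
    using \<delta>(1) by blast
qed

end
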